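(* The only (connected, maximal) hyperbolic $c_+$-grim reapers, and likewise the only (connected, maximal) hyperbolic $c_-$-grim reapers, of $\mathbb{H}^2\times\mathbb{R}$ are the vertical plane of equation $x=0$ and the slices $\mathbb{H}^2\times\{z_0\}$, $z_0\in\mathbb{R}$.
   Context: $\mathbb{H}^2\times\mathbb{R}$ is $\{(x,y,z)\in\mathbb{R}^3: y>0\}$ with metric $\frac{dx^2+dy^2}{y^2}+dz^2$. For an orientable immersed surface $\Sigma$ with unit normal $N$, $H$ denotes the mean curvature with respect to $N$, i.e. half the trace of the second fundamental form $\langle N,\overline\nabla_{\cdot}\,\cdot\rangle$. A hyperbolic $c_+$-grim reaper (resp. $c_-$-grim reaper) is a surface satisfying $H=\langle N,\partial_y\rangle$ (resp. $H=-\langle N,\partial_y\rangle$) and invariant by all hyperbolic translations $(x,y,z)\mapsto(e^tx,e^ty,z)$, $t\in\mathbb{R}$; it is parametrized by $\Psi(s,t)=(e^t\cos r(s),e^t\sin r(s),z(s))$ with $r(s)\in(0,\pi)$. "Maximal" means that the generating curve $(\cos r(s),\sin r(s),z(s))$ is not properly extendable within the same class (otherwise one obtains open subsets of the listed surfaces). *)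

theory Defs
  imports "HOL-Analysis.Analysis"
begin

section \<open>The Riemannian manifold \<open>H\<^sup>2 \<times> R\<close>\<close>

definition H2R :: "(real^3) set" where
  "H2R = {p. p $ 2 > 0}"

text \<open>Vectors tangent at a point \<open>p\<close> are identified with their coordinates in the frame
  \<open>\<partial>\<^sub>x, \<partial>\<^sub>y, \<partial>\<^sub>z\<close>, i.e. with the vectors \<open>axis 1 1, axis 2 1, axis 3 1\<close>.\<close>

definition metric :: "real^3 \<Rightarrow> real^3 \<Rightarrow> real^3 \<Rightarrow> real" where
  "metric p v w = (v $ 1 * w $ 1 + v $ 2 * w $ 2) / (p $ 2)\<^sup>2 + v $ 3 * w $ 3"

definition metric_coeff :: "real^3 \<Rightarrow> real^3^3" where
  "metric_coeff p = (\<chi> i j. metric p (axis i 1) (axis j 1))"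

definition pd :: "(real^'n \<Rightarrow> 'b::real_normed_vector) \<Rightarrow> 'n \<Rightarrow> real^'n \<Rightarrow> 'b" where
  "pd f i p = frechet_derivative f (at p) (axis i 1)"

text \<open>\<open>christoffel p k i j\<close> is the Levi-Civita symbol with upper index \<open>k\<close> and lower indices
  \<open>i, j\<close>.\<close>

definition christoffel :: "real^3 \<Rightarrow> 3 \<Rightarrow> 3 \<Rightarrow> 3 \<Rightarrow> real" where
  "christoffel p k i j =
     1/2 * (\<Sum>l\<in>UNIV. matrix_inv (metric_coeff p) $ k $ l *
       (pd (\<lambda>q. metric_coeff q $ j $ l) i p
        + pd (\<lambda>q. metric_coeff q $ i $ l) j p
        - pd (\<lambda>q. metric_coeff q $ i $ j) l p))"


section \<open>Immersed surfaces and their mean curvature\<close>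

definition immersion_on :: "(real^2) set \<Rightarrow> (real^2 \<Rightarrow> real^3) \<Rightarrow> bool" where
  "immersion_on U X \<longleftrightarrow>
     open U \<and> X ` U \<subseteq> H2R \<and>
     (\<forall>u\<in>U. X differentiable (at u) \<and> inj (frechet_derivative X (at u)))"

definition unit_normal_on :: "(real^2) set \<Rightarrow> (real^2 \<Rightarrow> real^3) \<Rightarrow> (real^2 \<Rightarrow> real^3) \<Rightarrow> bool" where
  "unit_normal_on U X N \<longleftrightarrow>
     continuous_on U N \<and>
     (\<forall>u\<in>U. metric (X u) (N u) (N u) = 1 \<and> (\<forall>a. metric (X u) (N u) (pd X a u) = 0))"

definition first_ff :: "(real^2 \<Rightarrow> real^3) \<Rightarrow> real^2 \<Rightarrow> real^2^2" where
  "first_ff X u = (\<chi> a b. metric (X u) (pd X a u) (pd X b u))"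

text \<open>The ambient covariant derivative of the coordinate field \<open>\<partial>\<^sub>b X\<close> in the direction
  \<open>\<partial>\<^sub>a X\<close>.\<close>

definition cov_deriv :: "(real^2 \<Rightarrow> real^3) \<Rightarrow> 2 \<Rightarrow> 2 \<Rightarrow> real^2 \<Rightarrow> real^3" where
  "cov_deriv X a b u = (\<chi> k. pd (pd X b) a u $ k
     + (\<Sum>i\<in>UNIV. \<Sum>j\<in>UNIV. christoffel (X u) k i j * pd X a u $ i * pd X b u $ j))"

definition second_ff :: "(real^2 \<Rightarrow> real^3) \<Rightarrow> (real^2 \<Rightarrow> real^3) \<Rightarrow> real^2 \<Rightarrow> real^2^2" where
  "second_ff X N u = (\<chi> a b. metric (X u) (N u) (cov_deriv X a b u))"

text \<open>The trace of the second fundamental form is taken with respect to the induced metric.\<close>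

definition mean_curvature :: "(real^2 \<Rightarrow> real^3) \<Rightarrow> (real^2 \<Rightarrow> real^3) \<Rightarrow> real^2 \<Rightarrow> real" where
  "mean_curvature X N u = trace (matrix_inv (first_ff X u) ** second_ff X N u) / 2"

text \<open>The equation \<open>H = \<epsilon> \<langle>N, \<partial>\<^sub>y\<rangle>\<close>; both sides change sign with \<open>N\<close>, so the choice of the unit
  normal is immaterial.\<close>

definition grim_reaper_on :: "real \<Rightarrow> (real^2) set \<Rightarrow> (real^2 \<Rightarrow> real^3) \<Rightarrow> bool" where
  "grim_reaper_on \<epsilon> U X \<longleftrightarrow>
     immersion_on U X \<and>
     (\<exists>N. unit_normal_on U X N \<and>
        (\<forall>u\<in>U. mean_curvature X N u = \<epsilon> * metric (X u) (N u) (axis 2 1)))"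


section \<open>Hyperbolic grim reapers\<close>

definition hyp_translation :: "real \<Rightarrow> real^3 \<Rightarrow> real^3" where
  "hyp_translation t p = vector [exp t * p $ 1, exp t * p $ 2, p $ 3]"

definition smooth_on_real :: "real set \<Rightarrow> (real \<Rightarrow> real) \<Rightarrow> bool" where
  "smooth_on_real I f \<longleftrightarrow> (\<forall>n. \<forall>s\<in>I. (deriv ^^ n) f differentiable (at s))"

definition profile_curve :: "(real \<Rightarrow> real) \<Rightarrow> (real \<Rightarrow> real) \<Rightarrow> real \<Rightarrow> real^3" where
  "profile_curve r z s = vector [cos (r s), sin (r s), z s]"

definition hyp_surface :: "(real \<Rightarrow> real) \<Rightarrow> (real \<Rightarrow> real) \<Rightarrow> real^2 \<Rightarrow> real^3" where
  "hyp_surface r z u = hyp_translation (u $ 2) (profile_curve r z (u $ 1))"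

definition strip :: "real set \<Rightarrow> (real^2) set" where
  "strip I = {u. u $ 1 \<in> I}"

text \<open>The generating curve is defined on a nonempty open interval, so that the surface is connected;
  it is regular because \<open>grim_reaper_on\<close> requires an immersion.\<close>

definition hyp_grim_reaper :: "real \<Rightarrow> real set \<Rightarrow> (real \<Rightarrow> real) \<Rightarrow> (real \<Rightarrow> real) \<Rightarrow> bool" where
  "hyp_grim_reaper \<epsilon> I r z \<longleftrightarrow>
     open I \<and> connected I \<and> I \<noteq> {} \<and>
     smooth_on_real I r \<and> smooth_on_real I z \<and> r ` I \<subseteq> {0<..<pi} \<and>
     grim_reaper_on \<epsilon> (strip I) (hyp_surface r z) \<and>
     (\<forall>t. hyp_translation t ` (hyp_surface r z ` strip I) = hyp_surface r z ` strip I)"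

text \<open>Extensions of a generating curve are understood up to regular reparametrization \<open>\<phi>\<close>
  (otherwise a proper piece of a curve, parametrized on the whole line, would count as
  non-extendable). The extension is proper iff \<open>\<phi> ` I \<noteq> J\<close>.\<close>

definition curve_embeds ::
    "real set \<Rightarrow> (real \<Rightarrow> real^3) \<Rightarrow> real set \<Rightarrow> (real \<Rightarrow> real^3) \<Rightarrow> (real \<Rightarrow> real) \<Rightarrow> bool" where
  "curve_embeds I \<gamma> J \<delta> \<phi> \<longleftrightarrow>
     smooth_on_real I \<phi> \<and> (\<forall>s\<in>I. deriv \<phi> s \<noteq> 0) \<and> \<phi> ` I \<subseteq> J \<and> (\<forall>s\<in>I. \<gamma> s = \<delta> (\<phi> s))"

definition maximal_hyp_grim_reaper ::
    "real \<Rightarrow> real set \<Rightarrow> (real \<Rightarrow> real) \<Rightarrow> (real \<Rightarrow> real) \<Rightarrow> bool" where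
  "maximal_hyp_grim_reaper \<epsilon> I r z \<longleftrightarrow>
     hyp_grim_reaper \<epsilon> I r z \<and>
     (\<forall>J \<rho> \<zeta> \<phi>. hyp_grim_reaper \<epsilon> J \<rho> \<zeta> \<and>
        curve_embeds I (profile_curve r z) J (profile_curve \<rho> \<zeta>) \<phi> \<longrightarrow> \<phi> ` I = J)"

definition maximal_hyp_c_plus_grim_reapers :: "(real^3) set set" where
  "maximal_hyp_c_plus_grim_reapers =
     {hyp_surface r z ` strip I | I r z. maximal_hyp_grim_reaper 1 I r z}"

definition maximal_hyp_c_minus_grim_reapers :: "(real^3) set set" where
  "maximal_hyp_c_minus_grim_reapers =
     {hyp_surface r z ` strip I | I r z. maximal_hyp_grim_reaper (-1) I r z}"

definition vertical_plane :: "(real^3) set" where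
  "vertical_plane = {p \<in> H2R. p $ 1 = 0}"

definition slice :: "real \<Rightarrow> (real^3) set" where
  "slice z0 = {p \<in> H2R. p $ 3 = z0}"

end

theory Submission
  imports Defs
begin

text \<open>
  The mean curvature is invariant under the isometries \<open>(x, y, z) \<mapsto> (e\<^sup>t x, e\<^sup>t y, z)\<close>, but the
  field \<open>\<partial>\<^sub>y\<close> is not: these maps multiply \<open>\<langle>N, \<partial>\<^sub>y\<rangle>\<close> by \<open>e\<^sup>-\<^sup>t\<close>. On an invariant surface the equation
  \<open>H = \<epsilon> \<langle>N, \<partial>\<^sub>y\<rangle>\<close> with \<open>\<epsilon> \<noteq> 0\<close> therefore equates a function that is constant along orbits with one
  that decays along them, so \<open>\<langle>N, \<partial>\<^sub>y\<rangle> = 0\<close>. As \<open>N\<close> is also orthogonal to the orbit direction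
  \<open>(cos r, sin r, 0)\<close> and to the profile curve, this gives \<open>z' cos r = 0\<close>
  (\<open>hyp_grim_reaper_vertical_or_horizontal\<close>).

  The curve is regular, so on the open set where \<open>z' \<noteq> 0\<close> the angle \<open>r\<close> is \<open>\<pi>/2\<close>, and everywhere else
  \<open>r' \<noteq> 0\<close>. Both conditions are open and they exclude each other; on a connected
  parameter interval exactly one of them holds throughout (\<open>hyp_grim_reaper_dichotomy\<close>). In the
  first case \<open>z\<close> itself is a reparametrization of the curve onto part of the line \<open>x = 0\<close>, in the
  second case \<open>r\<close> reparametrizes it onto part of a half circle at constant height. Maximal curves
  fill the whole line or half circle.

  Conversely, the plane \<open>x = 0\<close> and the slices are totally geodesic and \<open>\<partial>\<^sub>y\<close> is tangent to them, so
  both sides of the equation vanish (\<open>hyp_grim_reaper_of_constant_coordinate\<close>). Their profile curves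
  are maximal: by the dichotomy, an extension is again vertical or horizontal, with an injective
  coordinate function (\<open>z\<close> or \<open>r\<close>), and this coordinate already takes all its possible values on
  the given curve.
\<close>

section \<open>The Levi-Civita connection in coordinates\<close>

text \<open>The generator at \<open>p\<close> of the one-parameter group of hyperbolic translations.\<close>

definition horiz :: "real^3 \<Rightarrow> real^3" where
  "horiz p = vector [p $ 1, p $ 2, 0]"

text \<open>The bilinear form \<open>(v, w) \<mapsto> \<Gamma>(v, w)\<close> given by the Christoffel symbols; up to symmetry, the only nonzero ones are
  \<open>\<Gamma>\<^sup>x\<^sub>x\<^sub>y = \<Gamma>\<^sup>y\<^sub>y\<^sub>y = - 1 / y\<close> and \<open>\<Gamma>\<^sup>y\<^sub>x\<^sub>x = 1 / y\<close>.\<close>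

definition christoffel_form :: "real^3 \<Rightarrow> real^3 \<Rightarrow> real^3 \<Rightarrow> real^3" where
  "christoffel_form p v w =
     vector [- (v $ 1 * w $ 2 + v $ 2 * w $ 1) / p $ 2, (v $ 1 * w $ 1 - v $ 2 * w $ 2) / p $ 2, 0]"

lemma metric_coeff_entry:
  "metric_coeff p $ i $ j = (if i \<noteq> j then 0 else if i = 3 then 1 else 1 / (p $ 2)\<^sup>2)"
proof -
  have "\<forall>i j. metric_coeff p $ i $ j = (if i \<noteq> j then 0 else if i = 3 then 1 else 1 / (p $ 2)\<^sup>2)"
    by (simp add: metric_coeff_def metric_def axis_def forall_3)
  then show ?thesis by blast
qed

lemma matrix_inv_metric_coeff:
  assumes "p \<in> H2R"
  shows "matrix_inv (metric_coeff p) $ k $ l =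
    (if k \<noteq> l then 0 else if k = 3 then 1 else (p $ 2)\<^sup>2)"
proof -
  define B :: "real^3^3" where
    "B = (\<chi> k l. if k \<noteq> l then 0 else if k = 3 then 1 else (p $ 2)\<^sup>2)"
  have y: "p $ 2 \<noteq> 0" using assms by (simp add: H2R_def)
  have 1: "metric_coeff p ** B = mat 1"
    using y by (simp add: vec_eq_iff matrix_matrix_mult_def mat_def sum_3 forall_3 metric_coeff_entry B_def)
  have 2: "B ** metric_coeff p = mat 1"
    using y by (simp add: vec_eq_iff matrix_matrix_mult_def mat_def sum_3 forall_3 metric_coeff_entry B_def)
  let ?M = "matrix_inv (metric_coeff p)"
  have "invertible (metric_coeff p)" using 1 2 unfolding invertible_def by blast
  then have "?M ** metric_coeff p = mat 1"
    unfolding matrix_inv_def invertible_def by (rule someI2_ex) blast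
  then have "?M = B"
    using 1 by (metis matrix_mul_assoc matrix_mul_lid matrix_mul_rid)
  then show ?thesis by (simp add: B_def)
qed

lemma pd_const [simp]: "pd (\<lambda>q. c) i p = 0"
  by (simp add: pd_def)

lemma has_derivative_vec_nth_ident [derivative_intros]:
  "((\<lambda>q::real^'n. q $ i) has_derivative (\<lambda>v. v $ i)) F"
  by (rule bounded_linear_imp_has_derivative[OF bounded_linear_vec_nth])

lemma pd_inverse_height_squared:
  assumes "(p::real^3) $ 2 \<noteq> 0"
  shows "pd (\<lambda>q. 1 / (q $ 2)\<^sup>2) i p = (if i = 2 then - 2 / (p $ 2) ^ 3 else 0)"
proof -
  have "((\<lambda>q::real^3. 1 / (q $ 2)\<^sup>2) has_derivative (\<lambda>v. - 2 / (p $ 2) ^ 3 * v $ 2)) (at p)"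
    using assms
    by (auto intro!: derivative_eq_intros simp: power2_eq_square power3_eq_cube field_simps)
  then have "frechet_derivative (\<lambda>q::real^3. 1 / (q $ 2)\<^sup>2) (at p) = (\<lambda>v. - 2 / (p $ 2) ^ 3 * v $ 2)"
    using frechet_derivative_at by metis
  then show ?thesis by (simp add: pd_def axis_def)
qed

lemma pd_metric_coeff:
  assumes "p \<in> H2R"
  shows "pd (\<lambda>q. metric_coeff q $ i $ j) k p =
    (if i = j \<and> i \<noteq> 3 \<and> k = 2 then - 2 / (p $ 2) ^ 3 else 0)"
  using assms
  by (cases "i = j"; cases "i = 3") (simp_all add: metric_coeff_entry pd_inverse_height_squared H2R_def)

lemma christoffel_sum_eq_form:
  assumes "p \<in> H2R"
  shows "(\<Sum>i\<in>UNIV. \<Sum>j\<in>UNIV. christoffel p k i j * v $ i * w $ j) = christoffel_form p v w $ k"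
proof -
  have y: "p $ 2 \<noteq> 0" using assms by (simp add: H2R_def)
  have "\<forall>k. (\<Sum>i\<in>UNIV. \<Sum>j\<in>UNIV. christoffel p k i j * v $ i * w $ j) = christoffel_form p v w $ k"
    using y
    by (simp add: christoffel_def christoffel_form_def sum_3 forall_3
        matrix_inv_metric_coeff[OF assms] pd_metric_coeff[OF assms])
       (simp add: field_simps power2_eq_square power3_eq_cube)
  then show ?thesis by blast
qed

lemma cov_deriv_eq:
  assumes "X u \<in> H2R"
  shows "cov_deriv X a b u = pd (pd X b) a u + christoffel_form (X u) (pd X a u) (pd X b u)"
  by (simp add: cov_deriv_def vec_eq_iff christoffel_sum_eq_form[OF assms])


section \<open>Equivariance under hyperbolic translations\<close>

lemma hyp_translation_nth [simp]:
  "hyp_translation t p $ 1 = exp t * p $ 1"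
  "hyp_translation t p $ 2 = exp t * p $ 2"
  "hyp_translation t p $ 3 = p $ 3"
  by (simp_all add: hyp_translation_def)

lemma horiz_nth [simp]: "horiz p $ 1 = p $ 1" "horiz p $ 2 = p $ 2" "horiz p $ 3 = 0"
  by (simp_all add: horiz_def)

lemma christoffel_form_nth [simp]:
  "christoffel_form p v w $ 1 = - (v $ 1 * w $ 2 + v $ 2 * w $ 1) / p $ 2"
  "christoffel_form p v w $ 2 = (v $ 1 * w $ 1 - v $ 2 * w $ 2) / p $ 2"
  "christoffel_form p v w $ 3 = 0"
  by (simp_all add: christoffel_form_def)

lemma vec3_eq_iff: "(p::real^3) = q \<longleftrightarrow> p $ 1 = q $ 1 \<and> p $ 2 = q $ 2 \<and> p $ 3 = q $ 3"
  by (simp add: vec_eq_iff forall_3)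

lemma hyp_translation_add: "hyp_translation t (p + q) = hyp_translation t p + hyp_translation t q"
  by (simp add: vec3_eq_iff algebra_simps)

lemma hyp_translation_compose: "hyp_translation s (hyp_translation t p) = hyp_translation (s + t) p"
  by (simp add: vec3_eq_iff exp_add)

lemma hyp_translation_0 [simp]: "hyp_translation 0 p = p"
  by (simp add: vec3_eq_iff)

text \<open>Hyperbolic translations are linear in these coordinates, so each is its own differential. This
  lemma says that they are isometries.\<close>

lemma metric_hyp_translation:
  "metric (hyp_translation t p) (hyp_translation t v) (hyp_translation t w) = metric p v w"
proof -
  have "(exp t * a * (exp t * b) + exp t * c * (exp t * d)) / (exp t * y)\<^sup>2 = (a * b + c * d) / y\<^sup>2"
    for a b c d y :: real
  proof -
    have "exp t * a * (exp t * b) + exp t * c * (exp t * d) = (exp t)\<^sup>2 * (a * b + c * d)"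
      by (simp add: power2_eq_square algebra_simps)
    then show ?thesis by (simp add: power_mult_distrib)
  qed
  then show ?thesis by (simp add: metric_def)
qed

lemma christoffel_form_hyp_translation:
  "christoffel_form (hyp_translation t p) (hyp_translation t v) (hyp_translation t w)
     = hyp_translation t (christoffel_form p v w)"
proof -
  have "(exp t * a * (exp t * b) - exp t * c * (exp t * d)) / (exp t * y) = exp t * ((a * b - c * d) / y)"
    for a b c d y :: real
  proof -
    have "exp t * a * (exp t * b) - exp t * c * (exp t * d) = exp t * (exp t * (a * b - c * d))"
      by (simp add: algebra_simps)
    then show ?thesis by simp
  qed
  from this[of "v $ 1" "w $ 1" "v $ 2" "w $ 2" "p $ 2"] this[of "- v $ 1" "w $ 2" "v $ 2" "w $ 1" "p $ 2"]
  show ?thesis unfolding vec3_eq_iff hyp_translation_nth christoffel_form_nth by simp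
qed

text \<open>The equivariant field along the orbits whose value on the curve \<open>t = 0\<close> is \<open>w\<close>. An invariant
  surface, its coordinate fields and the covariant derivatives of these are all of this form.\<close>

definition orbit_field :: "(real \<Rightarrow> real^3) \<Rightarrow> real^2 \<Rightarrow> real^3" where
  "orbit_field w u = hyp_translation (u $ 2) (w (u $ 1))"

text \<open>Equivariant fields are closed under partial differentiation (\<open>pd_orbit_field\<close>); on the
  underlying functions of \<open>s\<close>, the derivative in \<open>s\<close> acts as \<open>d/ds\<close> and the derivative in \<open>t\<close> acts
  pointwise as the generator.\<close>

definition orbit_deriv :: "2 \<Rightarrow> (real \<Rightarrow> real^3) \<Rightarrow> real \<Rightarrow> real^3" where
  "orbit_deriv a w s = (if a = 1 then vector_derivative w (at s) else horiz (w s))"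

lemma hyp_surface_eq_orbit_field: "hyp_surface r z = orbit_field (profile_curve r z)"
  by (simp add: fun_eq_iff hyp_surface_def orbit_field_def)

lemma bounded_linear_horiz: "bounded_linear horiz"
  by (rule bounded_linearI'[of horiz]) (simp_all add: vec3_eq_iff)

lemma hyp_translation_decomp: "hyp_translation t p = exp t *\<^sub>R horiz p + (p $ 3) *\<^sub>R axis 3 1"
  by (simp add: vec3_eq_iff axis_def)

lemma has_derivative_orbit_field:
  assumes "(w has_vector_derivative w') (at (u $ 1))"
  shows "(orbit_field w has_derivative
    (\<lambda>v. hyp_translation (u $ 2) (v $ 1 *\<^sub>R w' + v $ 2 *\<^sub>R horiz (w (u $ 1))))) (at u)"
proof -
  have w: "((\<lambda>u::real^2. w (u $ 1)) has_derivative (\<lambda>v. v $ 1 *\<^sub>R w')) (at u)"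
  proof -
    have "(w has_derivative (\<lambda>x. x *\<^sub>R w')) (at (u $ 1))"
      using assms by (simp add: has_vector_derivative_def)
    moreover have "((\<lambda>u::real^2. u $ 1) has_derivative (\<lambda>v. v $ 1)) (at u)"
      by (auto intro!: derivative_eq_intros)
    ultimately show ?thesis
      using has_derivative_compose[of "\<lambda>u::real^2. u $ 1"] by blast
  qed
  have h: "((\<lambda>u::real^2. horiz (w (u $ 1))) has_derivative (\<lambda>v. horiz (v $ 1 *\<^sub>R w'))) (at u)"
    using bounded_linear.has_derivative[OF bounded_linear_horiz w] .
  have w3: "((\<lambda>u::real^2. w (u $ 1) $ 3) has_derivative (\<lambda>v. (v $ 1 *\<^sub>R w') $ 3)) (at u)"
    using bounded_linear.has_derivative[OF bounded_linear_vec_nth w] .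
  have e: "((\<lambda>u::real^2. exp (u $ 2)) has_derivative (\<lambda>v. exp (u $ 2) * v $ 2)) (at u)"
    by (auto intro!: derivative_eq_intros)
  have "((\<lambda>u. exp (u $ 2) *\<^sub>R horiz (w (u $ 1)) + (w (u $ 1) $ 3) *\<^sub>R axis 3 1) has_derivative
     (\<lambda>v. hyp_translation (u $ 2) (v $ 1 *\<^sub>R w' + v $ 2 *\<^sub>R horiz (w (u $ 1))))) (at u)"
    by (rule has_derivative_eq_rhs[OF has_derivative_add[OF has_derivative_scaleR[OF e h]
          has_derivative_scaleR[OF w3 has_derivative_const]]])
       (simp add: fun_eq_iff vec3_eq_iff axis_def algebra_simps)
  then show ?thesis
    by (simp add: orbit_field_def[abs_def] hyp_translation_decomp[of "_ $ 2" "w _"])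
qed

lemma orbit_field_differentiable:
  "w differentiable (at (u $ 1)) \<Longrightarrow> orbit_field w differentiable (at u)"
  by (rule differentiableI, rule has_derivative_orbit_field) (simp add: vector_derivative_works)

lemma pd_orbit_field:
  assumes "w differentiable (at (u $ 1))"
  shows "pd (orbit_field w) a u = orbit_field (orbit_deriv a w) u"
proof -
  have a: "a = 1 \<or> a = 2" using exhaust_2 by blast
  have "(w has_vector_derivative vector_derivative w (at (u $ 1))) (at (u $ 1))"
    using assms vector_derivative_works by blast
  from frechet_derivative_at[OF has_derivative_orbit_field[OF this], symmetric]
  show ?thesis using a
    by (auto simp: pd_def orbit_field_def orbit_deriv_def axis_def)
qed

lemma pd_cong_open:
  assumes "open U" "u \<in> U" "\<And>v. v \<in> U \<Longrightarrow> f v = g v"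
  shows "pd f i u = pd g i u"
proof -
  have "(f has_derivative D) (at u) \<longleftrightarrow> (g has_derivative D) (at u)" for D
    using has_derivative_transform_within_open[OF _ assms(1,2), of f D UNIV g]
      has_derivative_transform_within_open[OF _ assms(1,2), of g D UNIV f] assms(3) by auto
  then show ?thesis by (simp add: pd_def frechet_derivative_def)
qed

lemma open_strip: "open I \<Longrightarrow> open (strip I)"
proof -
  assume "open I"
  then have "open ((\<lambda>u::real^2. u $ 1) -` I)"
    by (intro open_vimage continuous_intros) auto
  then show ?thesis by (simp add: strip_def vimage_def)
qed

lemma pd_pd_orbit_field:
  assumes "open I" "u \<in> strip I"
    and "\<And>s. s \<in> I \<Longrightarrow> w differentiable (at s)"
    and "orbit_deriv b w differentiable (at (u $ 1))"
  shows "pd (pd (orbit_field w) b) a u = orbit_field (orbit_deriv a (orbit_deriv b w)) u"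
proof -
  have "pd (pd (orbit_field w) b) a u = pd (orbit_field (orbit_deriv b w)) a u"
    by (rule pd_cong_open[OF open_strip[OF assms(1)] assms(2)])
       (simp add: strip_def pd_orbit_field assms(3))
  then show ?thesis by (simp add: pd_orbit_field assms(4))
qed

text \<open>The connection is invariant under the isometries, so the covariant derivatives of the coordinate
  fields at time \<open>t\<close> are the translates of those at time \<open>0\<close>.\<close>

lemma cov_deriv_orbit_field:
  assumes "open I" "u \<in> strip I" "orbit_field w u \<in> H2R"
    and "\<And>s. s \<in> I \<Longrightarrow> w differentiable (at s)"
    and "\<And>s. s \<in> I \<Longrightarrow> orbit_deriv b w differentiable (at s)"
  shows "cov_deriv (orbit_field w) a b u = orbit_field
    (\<lambda>s. orbit_deriv a (orbit_deriv b w) s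
       + christoffel_form (w s) (orbit_deriv a w s) (orbit_deriv b w s)) u"
proof -
  have u: "u $ 1 \<in> I" using assms(2) by (simp add: strip_def)
  show ?thesis
    using pd_pd_orbit_field[OF assms(1,2,4) assms(5)[OF u]] pd_orbit_field[OF assms(4)[OF u]]
    by (simp add: cov_deriv_eq[where X = "orbit_field w", OF assms(3)])
       (simp add: orbit_field_def hyp_translation_add christoffel_form_hyp_translation)
qed


section \<open>Profile curves\<close>

lemma profile_curve_nth [simp]:
  "profile_curve r z s $ 1 = cos (r s)"
  "profile_curve r z s $ 2 = sin (r s)"
  "profile_curve r z s $ 3 = z s"
  by (simp_all add: profile_curve_def)

lemma has_vector_derivative_vector3:
  fixes f g h :: "real \<Rightarrow> real"
  assumes "(f has_real_derivative f') (at s)" "(g has_real_derivative g') (at s)"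
    "(h has_real_derivative h') (at s)"
  shows "((\<lambda>s. vector [f s, g s, h s] :: real^3) has_vector_derivative vector [f', g', h']) (at s)"
proof -
  have v: "(vector [a, b, c] :: real^3) = a *\<^sub>R axis 1 1 + b *\<^sub>R axis 2 1 + c *\<^sub>R axis 3 1" for a b c
    by (simp add: vec3_eq_iff axis_def)
  show ?thesis
    unfolding v using assms
    by (auto intro!: derivative_eq_intros)
qed

lemma has_vector_derivative_profile_curve:
  assumes "(r has_real_derivative r') (at s)" "(z has_real_derivative z') (at s)"
  shows "(profile_curve r z has_vector_derivative
    vector [- sin (r s) * r', cos (r s) * r', z']) (at s)"
  unfolding profile_curve_def[abs_def]
  by (rule has_vector_derivative_vector3) (auto intro!: derivative_eq_intros assms)

lemma smooth_on_realD:
  assumes "smooth_on_real I f" "s \<in> I"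
  shows "(f has_real_derivative deriv f s) (at s)"
    and "(deriv f has_real_derivative deriv (deriv f) s) (at s)"
proof -
  have "f differentiable (at s)" "deriv f differentiable (at s)"
    using assms unfolding smooth_on_real_def
    by (force dest: spec[of _ 0], force dest: spec[of _ 1])
  then show "(f has_real_derivative deriv f s) (at s)"
    "(deriv f has_real_derivative deriv (deriv f) s) (at s)"
    by (simp_all add: DERIV_deriv_iff_real_differentiable)
qed

lemma orbit_deriv_profile_curve:
  assumes "smooth_on_real I r" "smooth_on_real I z" "s \<in> I"
  shows "orbit_deriv 1 (profile_curve r z) s =
      vector [- sin (r s) * deriv r s, cos (r s) * deriv r s, deriv z s]"
    and "orbit_deriv 2 (profile_curve r z) s = vector [cos (r s), sin (r s), 0]"
  using vector_derivative_at[OF has_vector_derivative_profile_curve[OF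
        smooth_on_realD(1)[OF assms(1,3)] smooth_on_realD(1)[OF assms(2,3)]]]
  by (simp_all add: orbit_deriv_def vec3_eq_iff)

lemma differentiable_transform_open:
  fixes f g :: "real \<Rightarrow> 'a::real_normed_vector"
  assumes "g differentiable (at s)" "open I" "s \<in> I" "\<And>t. t \<in> I \<Longrightarrow> g t = f t"
  shows "f differentiable (at s)"
  using assms has_derivative_transform_within_open[of g _ s UNIV I f]
  unfolding differentiable_def by blast

lemma profile_curve_differentiable:
  assumes "smooth_on_real I r" "smooth_on_real I z" "s \<in> I"
  shows "profile_curve r z differentiable (at s)"
  using has_vector_derivative_profile_curve[OF
        smooth_on_realD(1)[OF assms(1,3)] smooth_on_realD(1)[OF assms(2,3)]]
  by (metis differentiableI_vector)

lemma orbit_deriv_profile_curve_differentiable: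
  assumes "open I" "smooth_on_real I r" "smooth_on_real I z" "s \<in> I"
  shows "orbit_deriv b (profile_curve r z) differentiable (at s)"
proof -
  note d = smooth_on_realD[OF assms(2,4)] smooth_on_realD[OF assms(3,4)]
  have "(\<lambda>s. vector [- sin (r s) * deriv r s, cos (r s) * deriv r s, deriv z s] :: real^3)
      differentiable (at s)"
    by (rule differentiableI_vector, rule has_vector_derivative_vector3)
       (auto intro!: derivative_eq_intros d)
  then have 1: "orbit_deriv 1 (profile_curve r z) differentiable (at s)"
    by (rule differentiable_transform_open[OF _ assms(1,4)])
       (simp add: orbit_deriv_profile_curve(1)[OF assms(2,3)])
  have "(\<lambda>s. vector [cos (r s), sin (r s), 0] :: real^3) differentiable (at s)"
    by (rule differentiableI_vector, rule has_vector_derivative_vector3)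
       (auto intro!: derivative_eq_intros d)
  then have 2: "orbit_deriv 2 (profile_curve r z) differentiable (at s)"
    by (rule differentiable_transform_open[OF _ assms(1,4)])
       (simp add: orbit_deriv_profile_curve(2)[OF assms(2,3)])
  show ?thesis using 1 2 exhaust_2[of b] by auto
qed

lemma hyp_surface_in_H2R:
  assumes "r ` I \<subseteq> {0<..<pi}" "u \<in> strip I"
  shows "hyp_surface r z u \<in> H2R"
  using assms by (auto simp: H2R_def hyp_surface_def strip_def sin_gt_zero image_subset_iff)

lemma hyp_surface_hyp_translation_invariant:
  "hyp_translation t ` (hyp_surface r z ` strip I) = hyp_surface r z ` strip I"
proof -
  have sub: "hyp_translation t ` (hyp_surface r z ` strip I) \<subseteq> hyp_surface r z ` strip I" for t
  proof clarify
    fix u :: "real^2" assume u: "u \<in> strip I"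
    let ?v = "vector [u $ 1, t + u $ 2] :: real^2"
    have "hyp_translation t (hyp_surface r z u) = hyp_surface r z ?v"
      by (simp add: hyp_surface_def hyp_translation_compose)
    moreover have "?v \<in> strip I" using u by (simp add: strip_def)
    ultimately show "hyp_translation t (hyp_surface r z u) \<in> hyp_surface r z ` strip I" by blast
  qed
  have "p \<in> hyp_translation t ` (hyp_surface r z ` strip I)" if "p \<in> hyp_surface r z ` strip I" for p
  proof -
    have "p = hyp_translation t (hyp_translation (-t) p)" by (simp add: hyp_translation_compose)
    with sub[of "-t"] that show ?thesis by blast
  qed
  with sub[of t] show ?thesis by blast
qed


section \<open>The grim reaper equation forces a vertical or a horizontal profile\<close>

lemma unit_vectors_orthogonal_to_common_plane_vector:
  fixes a b c d p q :: real
  assumes "a\<^sup>2 + b\<^sup>2 = 1" "c\<^sup>2 + d\<^sup>2 = 1" "a * p + b * q = 0" "c * p + d * q = 0" "p \<noteq> 0 \<or> q \<noteq> 0"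
  obtains \<sigma> :: real where "\<sigma>\<^sup>2 = 1" "c = \<sigma> * a" "d = \<sigma> * b"
proof
  \<comment> \<open>the inner product of two unit vectors on the same line is \<open>1\<close> or \<open>- 1\<close>\<close>
  let ?\<sigma> = "a * c + b * d"
  have "(a * d - b * c) * p = 0" "(a * d - b * c) * q = 0"
    using assms(3,4) by algebra+
  then have det: "a * d - b * c = 0" using assms(5) by auto
  show "?\<sigma>\<^sup>2 = 1" using det assms(1,2) by algebra
  show "c = ?\<sigma> * a" using det assms(1) by algebra
  show "d = ?\<sigma> * b" using det assms(1) by algebra
qed

lemma metric_scaleR: "metric p (c *\<^sub>R v) w = c * metric p v w"
  by (simp add: metric_def algebra_simps add_divide_distrib)

text \<open>A surface has at most two unit normals at a point. For the tangent plane spanned by the profile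
  direction \<open>v1\<close> and the orbit direction \<open>v2\<close>, orthogonality to \<open>v2\<close> leaves a component \<open>l\<close> in the
  angular direction and the vertical component; these two form a unit vector of the Euclidean
  plane that is orthogonal to \<open>(r', z' sin \<theta>)\<close>.\<close>

lemma unit_normals_proportional:
  fixes r' z' \<theta> :: real
  assumes p: "p $ 2 = sin \<theta>" "sin \<theta> > 0"
    and v1: "v1 = vector [- sin \<theta> * r', cos \<theta> * r', z']"
    and v2: "v2 = vector [cos \<theta>, sin \<theta>, 0]"
    and reg: "r' \<noteq> 0 \<or> z' \<noteq> 0"
    and n: "metric p n n = 1" "metric p n v1 = 0" "metric p n v2 = 0"
    and m: "metric p m m = 1" "metric p m v1 = 0" "metric p m v2 = 0"
  obtains \<sigma> :: real where "\<sigma>\<^sup>2 = 1" "m = \<sigma> *\<^sub>R n"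
proof -
  let ?s = "sin \<theta>" and ?c = "cos \<theta>"
  have sc: "?s\<^sup>2 + ?c\<^sup>2 = 1" by simp
  have polar: "\<exists>l. k $ 1 = - l * ?s\<^sup>2 \<and> k $ 2 = l * ?s * ?c \<and> l\<^sup>2 + (k $ 3)\<^sup>2 = 1 \<and> l * r' + k $ 3 * (z' * ?s) = 0"
    if k: "metric p k k = 1" "metric p k v1 = 0" "metric p k v2 = 0" for k
  proof -
    \<comment> \<open>\<open>l\<close> is normalized so that the metric becomes the Euclidean one in \<open>(l, k $ 3)\<close>\<close>
    define l where "l = (k $ 2 * ?c - k $ 1 * ?s) / ?s"
    have l: "l * ?s = k $ 2 * ?c - k $ 1 * ?s" using p(2) by (simp add: l_def)
    have k1: "k $ 1 * ?c + k $ 2 * ?s = 0" using k(3) p by (simp add: metric_def v2)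
    have "k $ 1 = - l * ?s\<^sup>2" using l k1 sc by algebra
    moreover have "k $ 2 = l * ?s * ?c" using l k1 sc by algebra
    moreover have "(k $ 1 * k $ 1 + k $ 2 * k $ 2) + k $ 3 * k $ 3 * ?s\<^sup>2 = ?s\<^sup>2"
      using k(1) p by (simp add: metric_def field_simps)
    moreover have "(k $ 1 * (- ?s * r') + k $ 2 * (?c * r')) + k $ 3 * z' * ?s\<^sup>2 = 0"
      using k(2) p by (simp add: metric_def v1 field_simps)
    ultimately have "?s\<^sup>2 * (l\<^sup>2 + (k $ 3)\<^sup>2 - 1) = 0" "?s * (l * r' + k $ 3 * (z' * ?s)) = 0"
      using sc by algebra+
    then show ?thesis
      using p(2) \<open>k $ 1 = - l * ?s\<^sup>2\<close> \<open>k $ 2 = l * ?s * ?c\<close> by auto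
  qed
  obtain l where l: "n $ 1 = - l * ?s\<^sup>2" "n $ 2 = l * ?s * ?c" "l\<^sup>2 + (n $ 3)\<^sup>2 = 1"
    "l * r' + n $ 3 * (z' * ?s) = 0" using polar[OF n] by blast
  obtain l' where l': "m $ 1 = - l' * ?s\<^sup>2" "m $ 2 = l' * ?s * ?c" "l'\<^sup>2 + (m $ 3)\<^sup>2 = 1"
    "l' * r' + m $ 3 * (z' * ?s) = 0" using polar[OF m] by blast
  have "r' \<noteq> 0 \<or> z' * ?s \<noteq> 0" using reg p(2) by auto
  from unit_vectors_orthogonal_to_common_plane_vector[OF l(3) l'(3) l(4) l'(4) this]
  obtain \<sigma> :: real where "\<sigma>\<^sup>2 = 1" "l' = \<sigma> * l" "m $ 3 = \<sigma> * n $ 3" .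
  then show ?thesis
    using l l' by (intro that[of \<sigma>]) (simp_all add: vec3_eq_iff)
qed

lemma mean_curvature_scaleR:
  assumes "first_ff X u = first_ff X v" "second_ff X N u = \<sigma> *\<^sub>R second_ff X N v"
  shows "mean_curvature X N u = \<sigma> * mean_curvature X N v"
  using assms by (simp add: mean_curvature_def trace_def matrix_matrix_mult_def sum_2 algebra_simps)

text \<open>If both derivatives vanished, the differential of the parametrization would kill the first
  coordinate direction.\<close>

lemma hyp_grim_reaper_regular:
  assumes "hyp_grim_reaper \<epsilon> I r z" "s \<in> I"
  shows "deriv r s \<noteq> 0 \<or> deriv z s \<noteq> 0"
proof (rule ccontr)
  assume deg: "\<not> ?thesis"
  let ?u = "vector [s, 0] :: real^2"
  have sm: "smooth_on_real I r" "smooth_on_real I z" and imm: "immersion_on (strip I) (hyp_surface r z)"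
    using assms(1) by (auto simp: hyp_grim_reaper_def grim_reaper_on_def)
  let ?D = "frechet_derivative (hyp_surface r z) (at ?u)"
  have "?u \<in> strip I" using assms(2) by (simp add: strip_def)
  then have inj: "inj ?D" and "hyp_surface r z differentiable (at ?u)"
    using imm by (auto simp: immersion_on_def)
  then have "?D 0 = 0"
    using frechet_derivative_works has_derivative_linear linear_0 by metis
  moreover have "?D (axis 1 1) = 0"
  proof -
    have "?D (axis 1 1) = pd (hyp_surface r z) 1 ?u" by (simp add: pd_def)
    also have "\<dots> = orbit_field (orbit_deriv 1 (profile_curve r z)) ?u"
      using profile_curve_differentiable[OF sm assms(2)]
      by (simp add: hyp_surface_eq_orbit_field pd_orbit_field)
    also have "\<dots> = 0"
      using deg by (simp add: orbit_field_def orbit_deriv_profile_curve[OF sm assms(2)] vec3_eq_iff)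
    finally show ?thesis .
  qed
  ultimately have "axis 1 1 = (0 :: real^2)" using inj by (metis injD)
  then show False by (metis axis_eq_0_iff zero_neq_one)
qed

text \<open>Comparing the equation at the two points \<open>t = 0\<close> and \<open>t = 1\<close> of one orbit is enough. The normal
  \<open>N\<close> need not be equivariant a priori, but after translation back to \<open>t = 0\<close> it is determined up to a
  sign \<open>\<sigma>\<close>, which appears on both sides and cancels.\<close>

lemma hyp_grim_reaper_vertical_or_horizontal:
  assumes "hyp_grim_reaper \<epsilon> I r z" "\<epsilon> \<noteq> 0" "s \<in> I"
  shows "deriv z s * cos (r s) = 0"
proof -
  let ?X = "hyp_surface r z" and ?w = "profile_curve r z"
  have I: "open I" and sm: "smooth_on_real I r" "smooth_on_real I z" and r: "r ` I \<subseteq> {0<..<pi}"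
    and gr: "grim_reaper_on \<epsilon> (strip I) ?X"
    using assms(1) by (auto simp: hyp_grim_reaper_def)
  obtain N where N: "unit_normal_on (strip I) ?X N"
    and H: "\<And>u. u \<in> strip I \<Longrightarrow> mean_curvature ?X N u = \<epsilon> * metric (?X u) (N u) (axis 2 1)"
    using gr by (auto simp: grim_reaper_on_def)
  \<comment> \<open>everything along the orbit of the point \<open>p\<close> is translated back to \<open>p\<close>\<close>
  define u where "u t = (vector [s, t] :: real^2)" for t
  define n where "n t = hyp_translation (- t) (N (u t))" for t
  define p where "p = ?w s"
  define v where "v a = orbit_deriv a ?w s" for a
  define C where "C a b = orbit_deriv a (orbit_deriv b ?w) s + christoffel_form p (v a) (v b)" for a b
  have u: "u t \<in> strip I" for t using assms(3) by (simp add: u_def strip_def)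
  have X: "?X (u t) = hyp_translation t p" for t by (simp add: hyp_surface_def u_def p_def)
  have v: "pd ?X a (u t) = hyp_translation t (v a)" for a t
    using profile_curve_differentiable[OF sm assms(3)]
    by (simp add: hyp_surface_eq_orbit_field pd_orbit_field u_def v_def orbit_field_def)
  have C: "cov_deriv ?X a b (u t) = hyp_translation t (C a b)" for a b t
    using cov_deriv_orbit_field[OF I u[of t] hyp_surface_in_H2R[OF r u, unfolded hyp_surface_eq_orbit_field]
        profile_curve_differentiable[OF sm] orbit_deriv_profile_curve_differentiable[OF I sm]]
    by (simp add: hyp_surface_eq_orbit_field u_def v_def orbit_field_def C_def p_def)
  have n: "N (u t) = hyp_translation t (n t)" for t
    by (simp add: n_def hyp_translation_compose)
  have unit: "metric p (n t) (n t) = 1" and ortho: "metric p (n t) (v a) = 0" for t a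
    using N u[of t] by (auto simp: unit_normal_on_def X n v metric_hyp_translation)
  have v12: "v 1 = vector [- sin (r s) * deriv r s, cos (r s) * deriv r s, deriv z s]"
    "v 2 = vector [cos (r s), sin (r s), 0]"
    using orbit_deriv_profile_curve[OF sm assms(3)] by (simp_all add: v_def)
  have pos: "sin (r s) > 0" using r assms(3) by (simp add: image_subset_iff sin_gt_zero)
  have p2: "p $ 2 = sin (r s)" by (simp add: p_def)
  obtain \<sigma> :: real where \<sigma>: "\<sigma>\<^sup>2 = 1" "n 1 = \<sigma> *\<^sub>R n 0"
    using unit_normals_proportional[OF p2 pos v12 hyp_grim_reaper_regular[OF assms(1,3)]
        unit[of 0] ortho[of 0 1] ortho[of 0 2] unit[of 1] ortho[of 1 1] ortho[of 1 2]] by blast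
  have "mean_curvature ?X N (u 1) = \<sigma> * mean_curvature ?X N (u 0)"
  proof (rule mean_curvature_scaleR)
    show "first_ff ?X (u 1) = first_ff ?X (u 0)"
      by (simp add: first_ff_def X v metric_hyp_translation del: hyp_translation_0)
    show "second_ff ?X N (u 1) = \<sigma> *\<^sub>R second_ff ?X N (u 0)"
      by (simp add: second_ff_def X n C metric_hyp_translation \<sigma>(2) metric_scaleR vec_eq_iff del: hyp_translation_0)
  qed
  moreover have "metric (?X (u 1)) (N (u 1)) (axis 2 1) = \<sigma> * (n 0 $ 2 / (p $ 2)\<^sup>2) / exp 1"
    by (simp add: X n \<sigma>(2) metric_def axis_def power2_eq_square)
  moreover have "metric (?X (u 0)) (N (u 0)) (axis 2 1) = n 0 $ 2 / (p $ 2)\<^sup>2"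
    by (simp add: X n metric_def axis_def)
  \<comment> \<open>\<open>H\<close> changes by the factor \<open>\<sigma>\<close> and \<open>\<langle>N, \<partial>\<^sub>y\<rangle>\<close> by the factor \<open>\<sigma> / e\<close>\<close>
  ultimately have "\<epsilon> * \<sigma> * (n 0 $ 2 / (p $ 2)\<^sup>2) * (1 / exp 1 - 1) = 0"
    by (auto simp: H[OF u] algebra_simps)
  moreover have "\<sigma> \<noteq> 0" using \<sigma>(1) by auto
  ultimately have n2: "n 0 $ 2 = 0"
    using assms(2) pos by (simp add: p2)
  then have n1: "n 0 $ 1 * cos (r s) = 0"
    using ortho[of 0 2] pos by (simp add: metric_def v12 p2)
  show ?thesis
  proof (cases "cos (r s) = 0")
    case False
    then have "n 0 $ 1 = 0" using n1 by simp
    then show ?thesis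
      using unit[of 0] ortho[of 0 1] n2 by (auto simp: metric_def v12)
  qed simp
qed

lemma continuous_on_deriv:
  assumes "smooth_on_real I f"
  shows "continuous_on I (deriv f)"
  using smooth_on_realD(2)[OF assms] by (meson DERIV_isCont continuous_at_imp_continuous_on)

text \<open>Where \<open>z' \<noteq> 0\<close>, the angle is locally constant, so \<open>r' = 0\<close>; hence the open sets \<open>{z' \<noteq> 0}\<close> and
  \<open>{r' \<noteq> 0}\<close> are disjoint. They cover the interval by regularity, so one of them is empty.\<close>

lemma hyp_grim_reaper_dichotomy:
  assumes "hyp_grim_reaper \<epsilon> I r z" "\<epsilon> \<noteq> 0"
  obtains "\<And>s. s \<in> I \<Longrightarrow> r s = pi / 2" "\<And>s. s \<in> I \<Longrightarrow> deriv z s \<noteq> 0"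
  | z0 where "\<And>s. s \<in> I \<Longrightarrow> z s = z0" "\<And>s. s \<in> I \<Longrightarrow> deriv r s \<noteq> 0"
proof -
  have I: "open I" "connected I" "I \<noteq> {}" and sm: "smooth_on_real I r" "smooth_on_real I z"
    and r: "r ` I \<subseteq> {0<..<pi}"
    using assms(1) by (auto simp: hyp_grim_reaper_def)
  define A where "A = {s \<in> I. deriv z s \<noteq> 0}"
  define B where "B = {s \<in> I. deriv r s \<noteq> 0}"
  have oA: "open A" and oB: "open B"
    using continuous_open_preimage[OF continuous_on_deriv[OF sm(2)] I(1), of "- {0}"]
      continuous_open_preimage[OF continuous_on_deriv[OF sm(1)] I(1), of "- {0}"]
    by (auto simp: A_def B_def vimage_def Int_def)
  have half: "r s = pi / 2" if "s \<in> A" for s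
  proof -
    have "cos (r s) = 0" "0 < r s" "r s < pi"
      using hyp_grim_reaper_vertical_or_horizontal[OF assms, of s] that r by (auto simp: A_def)
    then show ?thesis
      using cos_inj_pi[of "r s" "pi / 2"] pi_gt_zero by simp
  qed
  have disj: "A \<inter> B = {}"
  proof -
    have "deriv r s = 0" if "s \<in> A" for s
    proof -
      have "((\<lambda>s. pi / 2) has_real_derivative 0) (at s)" by simp
      then have "(r has_real_derivative 0) (at s)"
        by (rule has_field_derivative_transform_within_open[OF _ oA that]) (simp add: half)
      then show ?thesis by (rule DERIV_imp_deriv)
    qed
    then show ?thesis by (auto simp: B_def)
  qed
  have "I \<subseteq> A \<union> B" using hyp_grim_reaper_regular[OF assms(1)] by (auto simp: A_def B_def)
  then have "A \<inter> I = {} \<or> B \<inter> I = {}"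
    using connectedD[OF I(2) oA oB] disj by blast
  moreover have "A \<subseteq> I" "B \<subseteq> I" by (auto simp: A_def B_def)
  ultimately have "I = A \<or> I = B \<and> A = {}"
    using \<open>I \<subseteq> A \<union> B\<close> by blast
  then consider "I = A" | "I = B" "A = {}" by metis
  then show thesis
  proof cases
    case 1
    then have "deriv z s \<noteq> 0" if "s \<in> I" for s using that unfolding A_def by blast
    with half 1 that(1) show thesis by metis
  next
    case 2
    have z': "(z has_real_derivative 0) (at s)" if "s \<in> I" for s
      using smooth_on_realD(1)[OF sm(2) that] that \<open>A = {}\<close> by (force simp: A_def)
    have r': "deriv r s \<noteq> 0" if "s \<in> I" for s
      using that \<open>I = B\<close> unfolding B_def by blast
    have "\<exists>c. \<forall>s\<in>I. z s = c"
      using I(2) z' by (intro has_field_derivative_zero_constant)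
        (simp_all add: has_field_derivative_at_within is_interval_convex is_interval_connected_1)
    with that(2) r' show thesis by metis
  qed
qed


section \<open>The vertical plane and the slices\<close>

lemma smooth_on_real_id: "smooth_on_real I (\<lambda>s. s)"
proof -
  have "\<exists>a b. (deriv ^^ n) (\<lambda>s::real. s) = (\<lambda>s. a * s + b)" for n
  proof (induction n)
    case 0 show ?case by (intro exI[of _ 1] exI[of _ 0]) simp
  next
    case (Suc n)
    then obtain a b where "(deriv ^^ n) (\<lambda>s::real. s) = (\<lambda>s. a * s + b)" by blast
    moreover have "deriv (\<lambda>s. a * s + b) = (\<lambda>s. 0 * s + a)"
      by (auto intro!: ext DERIV_imp_deriv derivative_eq_intros)
    ultimately have "(deriv ^^ Suc n) (\<lambda>s::real. s) = (\<lambda>s. 0 * s + a)" by simp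
    then show ?case by blast
  qed
  moreover have "(\<lambda>s. a * s + b) differentiable (at s)" for a b s :: real
    by (intro derivative_intros)
  ultimately show ?thesis unfolding smooth_on_real_def by metis
qed

lemma smooth_on_real_const: "smooth_on_real I (\<lambda>s. c)"
proof -
  have "\<exists>d. (deriv ^^ n) (\<lambda>s::real. c) = (\<lambda>s. d)" for n
    by (induction n) auto
  then show ?thesis unfolding smooth_on_real_def by (metis differentiable_const)
qed

lemma hyp_grim_reaper_of_totally_geodesic:
  assumes "open I" "connected I" "I \<noteq> {}" "smooth_on_real I r" "smooth_on_real I z"
    and "r ` I \<subseteq> {0<..<pi}"
    and reg: "\<And>s. s \<in> I \<Longrightarrow> deriv r s \<noteq> 0 \<or> deriv z s \<noteq> 0"
    and N: "unit_normal_on (strip I) (hyp_surface r z) N"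
    and geod: "\<And>u. u \<in> strip I \<Longrightarrow> second_ff (hyp_surface r z) N u = 0"
    and N2: "\<And>u. N u $ 2 = 0"
  shows "hyp_grim_reaper \<epsilon> I r z"
proof -
  have "immersion_on (strip I) (hyp_surface r z)"
    unfolding immersion_on_def
  proof (intro conjI ballI)
    show "open (strip I)" by (rule open_strip[OF assms(1)])
    show "hyp_surface r z ` strip I \<subseteq> H2R" using hyp_surface_in_H2R[OF assms(6)] by blast
    fix u :: "real^2" assume u: "u \<in> strip I"
    then have s: "u $ 1 \<in> I" by (simp add: strip_def)
    let ?s = "u $ 1"
    let ?w' = "vector [- sin (r ?s) * deriv r ?s, cos (r ?s) * deriv r ?s, deriv z ?s] :: real^3"
    let ?D = "\<lambda>v::real^2. hyp_translation (u $ 2) (v $ 1 *\<^sub>R ?w' + v $ 2 *\<^sub>R horiz (profile_curve r z ?s))"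
    have D: "(hyp_surface r z has_derivative ?D) (at u)"
      unfolding hyp_surface_eq_orbit_field
      by (intro has_derivative_orbit_field has_vector_derivative_profile_curve
          smooth_on_realD(1)[OF assms(4) s] smooth_on_realD(1)[OF assms(5) s])
    then show "hyp_surface r z differentiable (at u)" by (rule differentiableI)
    have "inj ?D"
      unfolding linear_injective_0[OF has_derivative_linear[OF D]]
    proof (intro allI impI)
      fix v :: "real^2" assume "?D v = 0"
      then have e: "- (v $ 1 * (sin (r ?s) * deriv r ?s)) + v $ 2 * cos (r ?s) = 0"
        "v $ 1 * (cos (r ?s) * deriv r ?s) + v $ 2 * sin (r ?s) = 0" "v $ 1 * deriv z ?s = 0"
        by (simp_all add: vec3_eq_iff)
      have sc: "(sin (r ?s))\<^sup>2 + (cos (r ?s))\<^sup>2 = 1" by simp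
      have "v $ 1 * deriv r ?s = 0" "v $ 2 = 0" using e(1,2) sc by algebra+
      then show "v = 0" using e(3) reg[OF s] by (auto simp: vec_eq_iff forall_2)
    qed
    then show "inj (frechet_derivative (hyp_surface r z) (at u))"
      using frechet_derivative_at[OF D] by simp
  qed
  moreover have "mean_curvature (hyp_surface r z) N u
      = \<epsilon> * metric (hyp_surface r z u) (N u) (axis 2 1)" if "u \<in> strip I" for u
    using geod[OF that] N2[of u]
    by (simp add: mean_curvature_def metric_def axis_def trace_def matrix_matrix_mult_def)
  ultimately have "grim_reaper_on \<epsilon> (strip I) (hyp_surface r z)"
    using N unfolding grim_reaper_on_def by blast
  with assms show ?thesis
    by (simp add: hyp_grim_reaper_def hyp_surface_hyp_translation_invariant)
qed

lemma smooth_on_real_subset: "smooth_on_real J f \<Longrightarrow> I \<subseteq> J \<Longrightarrow> smooth_on_real I f"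
  by (auto simp: smooth_on_real_def)

text \<open>A coordinate that is constant along the curve vanishes in both derivatives. The first coordinate
  has to be \<open>0\<close>, because hyperbolic translations rescale it; they leave the third one alone.\<close>

lemma orbit_deriv_nth_eq_0:
  assumes "w differentiable (at s)" "\<And>t. w t $ i = c" "i = 1 \<and> c = 0 \<or> i = 3"
  shows "orbit_deriv a w s $ i = 0"
proof -
  have "(w has_vector_derivative vector_derivative w (at s)) (at s)"
    using assms(1) vector_derivative_works by blast
  from bounded_linear.has_vector_derivative[OF bounded_linear_vec_nth this, of i]
  have "((\<lambda>t. c) has_vector_derivative vector_derivative w (at s) $ i) (at s)"
    by (simp add: assms(2))
  then have "vector_derivative w (at s) $ i = 0"
    using has_vector_derivative_const vector_derivative_unique_at by metis
  then show ?thesis using assms(2)[of s] assms(3) by (auto simp: orbit_deriv_def)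
qed

text \<open>The plane \<open>x = 0\<close> (\<open>i = 1\<close>) and the slices (\<open>i = 3\<close>) are treated together. The normal is \<open>\<partial>\<^sub>i\<close>
  divided by its length. By the shape of the Christoffel symbols, the covariant derivatives of
  tangent fields have no \<open>i\<close>-th component, so the second fundamental form is zero. Smoothness is assumed on
  all of \<open>UNIV\<close> so that \<open>orbit_deriv_nth_eq_0\<close>, which needs a coordinate that is constant for every
  parameter, applies again to the derivatives.\<close>

lemma hyp_grim_reaper_of_constant_coordinate:
  assumes "open I" "connected I" "I \<noteq> {}" "smooth_on_real UNIV r" "smooth_on_real UNIV z"
    and r: "r ` I \<subseteq> {0<..<pi}"
    and reg: "\<And>s. s \<in> I \<Longrightarrow> deriv r s \<noteq> 0 \<or> deriv z s \<noteq> 0"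
    and c: "\<And>t. profile_curve r z t $ i = c" and i: "i = 1 \<and> c = 0 \<or> i = 3"
  shows "hyp_grim_reaper \<epsilon> I r z"
proof -
  let ?X = "hyp_surface r z" and ?w = "profile_curve r z"
  \<comment> \<open>\<open>k\<close> is the reciprocal of the length of \<open>\<partial>\<^sub>i\<close>, which is \<open>1 / y\<close> for \<open>i = 1\<close>\<close>
  define k where "k u = (if i = 3 then 1 else ?X u $ 2)" for u
  define N :: "real^2 \<Rightarrow> real^3" where "N u = k u *\<^sub>R axis i 1" for u
  have dw: "?w differentiable (at s)" for s
    using profile_curve_differentiable[OF assms(4,5)] by simp
  have ddw: "orbit_deriv b ?w differentiable (at s)" for b s
    using orbit_deriv_profile_curve_differentiable[OF open_UNIV assms(4,5)] by simp
  have H: "?X u \<in> H2R" if "u \<in> strip I" for u using hyp_surface_in_H2R[OF r that] .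
  have d1: "orbit_deriv a ?w s $ i = 0" for a s
    using orbit_deriv_nth_eq_0[OF dw c i] .
  have d2: "orbit_deriv a (orbit_deriv b ?w) s $ i = 0" for a b s
    using orbit_deriv_nth_eq_0[OF ddw d1] i by blast
  have nth: "orbit_field f u $ i = (if i = 3 then 1 else exp (u $ 2)) * f (u $ 1) $ i" for f u
    using i by (auto simp: orbit_field_def)
  have pd: "pd ?X a u $ i = 0" for a u
    by (simp add: hyp_surface_eq_orbit_field pd_orbit_field[OF dw] nth d1)
  have cov: "cov_deriv ?X a b u $ i = 0" if "u \<in> strip I" for a b u
    using H[OF that] i d1 d2
    by (auto simp: hyp_surface_eq_orbit_field nth
        cov_deriv_orbit_field[OF assms(1) that _ dw ddw])
  have mN: "metric p (N u) v = (if i = 3 then 1 else k u / (p $ 2)\<^sup>2) * v $ i" for p u v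
    using i by (auto simp: metric_def N_def axis_def k_def)
  show ?thesis
  proof (rule hyp_grim_reaper_of_totally_geodesic[OF assms(1-3) _ _ r reg, where N = N])
    show "smooth_on_real I r" "smooth_on_real I z"
      using smooth_on_real_subset assms(4,5) by blast+
    show "N u $ 2 = 0" for u using i by (auto simp: N_def axis_def)
    show "second_ff ?X N u = 0" if "u \<in> strip I" for u
      by (simp add: second_ff_def mN cov[OF that] vec_eq_iff)
    have "continuous_on (strip I) ?X"
      using orbit_field_differentiable[OF dw]
      by (simp add: hyp_surface_eq_orbit_field continuous_at_imp_continuous_on differentiable_imp_continuous_within)
    then have "continuous_on (strip I) N"
      unfolding N_def k_def by (cases "i = 3") (auto intro!: continuous_intros)
    moreover have "metric (?X u) (N u) (N u) = 1" if "u \<in> strip I" for u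
      using H[OF that] i by (auto simp: metric_def N_def axis_def k_def H2R_def power2_eq_square)
    ultimately show "unit_normal_on (strip I) ?X N"
      by (simp add: unit_normal_on_def mN pd)
  qed
qed

lemma hyp_grim_reaper_vertical_plane: "hyp_grim_reaper \<epsilon> UNIV (\<lambda>s. pi / 2) (\<lambda>s. s)"
proof (rule hyp_grim_reaper_of_constant_coordinate[where i = 1 and c = 0])
  show "smooth_on_real UNIV (\<lambda>s. pi / 2)" "smooth_on_real UNIV (\<lambda>s. s)"
    by (rule smooth_on_real_const smooth_on_real_id)+
qed auto

lemma hyp_grim_reaper_slice: "hyp_grim_reaper \<epsilon> {0<..<pi} (\<lambda>s. s) (\<lambda>s. z0)"
proof (rule hyp_grim_reaper_of_constant_coordinate[where i = 3 and c = z0])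
  show "smooth_on_real UNIV (\<lambda>s. s)" "smooth_on_real UNIV (\<lambda>s. z0)"
    by (rule smooth_on_real_const smooth_on_real_id)+
qed (auto simp: pi_gt_zero[THEN not_le[THEN iffD2]])

lemma hyp_surface_image_vertical_plane:
  "hyp_surface (\<lambda>s. pi / 2) (\<lambda>s. s) ` strip UNIV = vertical_plane"
proof (intro equalityI subsetI)
  fix p assume "p \<in> vertical_plane"
  then have "p = hyp_surface (\<lambda>s. pi / 2) (\<lambda>s. s) (vector [p $ 3, ln (p $ 2)])"
    by (simp add: vec3_eq_iff hyp_surface_def vertical_plane_def H2R_def)
  then show "p \<in> hyp_surface (\<lambda>s. pi / 2) (\<lambda>s. s) ` strip UNIV"
    by (auto simp: strip_def)
qed (auto simp: vertical_plane_def H2R_def hyp_surface_def)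

lemma hyp_surface_image_slice:
  "hyp_surface (\<lambda>s. s) (\<lambda>s. z0) ` strip {0<..<pi} = slice z0"
proof (intro equalityI subsetI)
  fix p assume "p \<in> slice z0"
  then have p: "p $ 2 > 0" "p $ 3 = z0" by (simp_all add: slice_def H2R_def)
  \<comment> \<open>polar coordinates in the upper half-plane; \<open>t = ln \<rho>\<close> is the translation parameter\<close>
  define \<rho> where "\<rho> = sqrt ((p $ 1)\<^sup>2 + (p $ 2)\<^sup>2)"
  have \<rho>: "\<rho> > 0" "\<rho>\<^sup>2 = (p $ 1)\<^sup>2 + (p $ 2)\<^sup>2"
    using p(1) by (simp_all add: \<rho>_def add_nonneg_pos)
  have "(p $ 1 / \<rho>)\<^sup>2 + (p $ 2 / \<rho>)\<^sup>2 = 1"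
    using \<rho> p(1) by (simp add: power_divide flip: add_divide_distrib)
  moreover have "0 \<le> p $ 2 / \<rho>" using \<rho>(1) p(1) by simp
  ultimately obtain \<theta> where \<theta>: "0 \<le> \<theta>" "\<theta> \<le> pi" "p $ 1 / \<rho> = cos \<theta>" "p $ 2 / \<rho> = sin \<theta>"
    using sincos_total_pi by blast
  have "\<theta> \<noteq> 0" "\<theta> \<noteq> pi" using \<theta>(4) p(1) \<rho>(1) by auto
  then have "vector [\<theta>, ln \<rho>] \<in> strip {0<..<pi}" using \<theta> by (simp add: strip_def)
  moreover have "p = hyp_surface (\<lambda>s. s) (\<lambda>s. z0) (vector [\<theta>, ln \<rho>])"
    using p \<rho>(1) by (simp add: vec3_eq_iff hyp_surface_def flip: \<theta>(3,4))
  ultimately show "p \<in> hyp_surface (\<lambda>s. s) (\<lambda>s. z0) ` strip {0<..<pi}" by blast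
qed (auto simp: slice_def H2R_def hyp_surface_def strip_def sin_gt_zero)


section \<open>Maximal curves\<close>

lemma inj_on_of_deriv_nonzero:
  fixes f :: "real \<Rightarrow> real"
  assumes "connected J" "smooth_on_real J f" "\<And>s. s \<in> J \<Longrightarrow> deriv f s \<noteq> 0"
  shows "inj_on f J"
proof (rule linorder_inj_onI')
  fix a b assume ab: "a \<in> J" "b \<in> J" "a < b"
  have sub: "{a..b} \<subseteq> J" using connected_contains_Icc[OF assms(1) ab(1,2)] .
  have d: "(f has_real_derivative deriv f s) (at s)" if "s \<in> {a..b}" for s
    using smooth_on_realD(1)[OF assms(2)] sub that by blast
  show "f a \<noteq> f b"
  proof
    assume "f a = f b"
    moreover have "continuous_on {a..b} f"
      using d by (meson DERIV_isCont continuous_at_imp_continuous_on)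
    moreover have "f differentiable (at s)" if "a < s" "s < b" for s
      using d[of s] that real_differentiable_def by auto
    ultimately obtain s where "a < s" "s < b" "(f has_real_derivative 0) (at s)"
      using Rolle[OF ab(3)] by blast
    moreover from this have "s \<in> J" using sub by auto
    ultimately show False using assms(3)[of s] DERIV_imp_deriv[of f 0 s] by simp
  qed
qed

lemma curve_embeds_nth:
  assumes "curve_embeds I (profile_curve r z) J (profile_curve \<rho> \<zeta>) \<phi>" "s \<in> I"
  shows "\<phi> s \<in> J" "cos (\<rho> (\<phi> s)) = cos (r s)" "\<zeta> (\<phi> s) = z s"
proof -
  have "profile_curve r z s = profile_curve \<rho> \<zeta> (\<phi> s)" "\<phi> s \<in> J"
    using assms by (auto simp: curve_embeds_def)
  then show "\<phi> s \<in> J" "cos (\<rho> (\<phi> s)) = cos (r s)" "\<zeta> (\<phi> s) = z s"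
    by (simp_all add: vec3_eq_iff)
qed

text \<open>An extension agrees with the given curve in the height \<open>\<zeta>\<close>, which therefore varies, so by the
  dichotomy \<open>\<zeta>\<close> is injective on \<open>J\<close>. Every height already occurs on the given curve, so the extension has
  no new points.\<close>

lemma maximal_vertical_plane:
  assumes "\<epsilon> \<noteq> 0"
  shows "maximal_hyp_grim_reaper \<epsilon> UNIV (\<lambda>s. pi / 2) (\<lambda>s. s)"
  unfolding maximal_hyp_grim_reaper_def
proof (intro conjI allI impI hyp_grim_reaper_vertical_plane, elim conjE)
  fix J \<rho> \<zeta> \<phi>
  assume J: "hyp_grim_reaper \<epsilon> J \<rho> \<zeta>"
    and e: "curve_embeds UNIV (profile_curve (\<lambda>s. pi / 2) (\<lambda>s. s)) J (profile_curve \<rho> \<zeta>) \<phi>"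
  have \<phi>: "\<phi> s \<in> J" "\<zeta> (\<phi> s) = s" for s
    using curve_embeds_nth(1,3)[OF e UNIV_I] by simp_all
  from J assms show "range \<phi> = J"
  proof (cases rule: hyp_grim_reaper_dichotomy)
    case 1
    then have "inj_on \<zeta> J"
      using J by (intro inj_on_of_deriv_nonzero) (auto simp: hyp_grim_reaper_def)
    then have "j = \<phi> (\<zeta> j)" if "j \<in> J" for j using \<phi> that by (metis inj_onD)
    then show ?thesis using \<phi>(1) by blast
  next
    case (2 z0)
    then have "(0::real) = 1" using \<phi>[of 0] \<phi>[of 1] by metis
    then show ?thesis by simp
  qed
qed

text \<open>The same argument with the angle in place of the height: an extension that contains more than one
  angle is horizontal, its angle function is injective with values in \<open>(0, \<pi>)\<close>, and all of these values
  occur on the given half circle.\<close>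

lemma maximal_slice:
  assumes "\<epsilon> \<noteq> 0"
  shows "maximal_hyp_grim_reaper \<epsilon> {0<..<pi} (\<lambda>s. s) (\<lambda>s. z0)"
  unfolding maximal_hyp_grim_reaper_def
proof (intro conjI allI impI hyp_grim_reaper_slice, elim conjE)
  fix J \<rho> \<zeta> \<phi>
  assume J: "hyp_grim_reaper \<epsilon> J \<rho> \<zeta>"
    and e: "curve_embeds {0<..<pi} (profile_curve (\<lambda>s. s) (\<lambda>s. z0)) J (profile_curve \<rho> \<zeta>) \<phi>"
  have \<rho>: "\<rho> j \<in> {0<..<pi}" if "j \<in> J" for j
    using J that by (auto simp: hyp_grim_reaper_def)
  have \<phi>: "\<phi> s \<in> J" "\<rho> (\<phi> s) = s" if "s \<in> {0<..<pi}" for s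
  proof -
    show "\<phi> s \<in> J" using curve_embeds_nth(1)[OF e that] .
    from \<rho>[OF this] show "\<rho> (\<phi> s) = s"
      using curve_embeds_nth(2)[OF e that] that cos_inj_pi[of "\<rho> (\<phi> s)" s] by simp
  qed
  from J assms show "\<phi> ` {0<..<pi} = J"
  proof (cases rule: hyp_grim_reaper_dichotomy)
    case 1
    \<comment> \<open>any angle other than \<open>\<pi>/2\<close> gives the contradiction\<close>
    moreover have "pi / 3 \<in> {0<..<pi}" by simp
    ultimately have "pi / 3 = pi / 2" using \<phi>[of "pi / 3"] by metis
    then show ?thesis by simp
  next
    case (2 z1)
    then have "inj_on \<rho> J"
      using J by (intro inj_on_of_deriv_nonzero) (auto simp: hyp_grim_reaper_def)
    then have "j = \<phi> (\<rho> j)" if "j \<in> J" for j using \<phi> \<rho> that by (metis inj_onD)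
    then show ?thesis using \<phi>(1) \<rho> by blast
  qed
qed

lemma hyp_surface_image_eq_of_curve_embeds:
  assumes e: "curve_embeds I (profile_curve r z) J (profile_curve \<rho> \<zeta>) \<phi>" and onto: "\<phi> ` I = J"
  shows "hyp_surface r z ` strip I = hyp_surface \<rho> \<zeta> ` strip J"
proof (intro equalityI subsetI; elim imageE)
  fix p and u :: "real^2" assume p: "p = hyp_surface r z u" "u \<in> strip I"
  let ?v = "vector [\<phi> (u $ 1), u $ 2] :: real^2"
  have "?v \<in> strip J" "p = hyp_surface \<rho> \<zeta> ?v"
    using p e by (auto simp: strip_def hyp_surface_def curve_embeds_def)
  then show "p \<in> hyp_surface \<rho> \<zeta> ` strip J" by blast
next
  fix p and v :: "real^2" assume p: "p = hyp_surface \<rho> \<zeta> v" "v \<in> strip J"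
  then obtain s where s: "s \<in> I" "v $ 1 = \<phi> s" using onto by (auto simp: strip_def)
  let ?u = "vector [s, v $ 2] :: real^2"
  have "?u \<in> strip I" "p = hyp_surface r z ?u"
    using p s e by (auto simp: strip_def hyp_surface_def curve_embeds_def)
  then show "p \<in> hyp_surface r z ` strip I" by blast
qed

text \<open>The coordinate with nonvanishing derivative embeds the profile curve into the one of the plane or
  of a slice, and maximality makes this embedding onto.\<close>

lemma maximal_hyp_grim_reaper_image:
  assumes max: "maximal_hyp_grim_reaper \<epsilon> I r z" and "\<epsilon> \<noteq> 0"
  shows "hyp_surface r z ` strip I \<in> {vertical_plane} \<union> range slice"
proof -
  have gr: "hyp_grim_reaper \<epsilon> I r z"
    and ext: "\<And>J \<rho> \<zeta> \<phi>. hyp_grim_reaper \<epsilon> J \<rho> \<zeta> \<Longrightarrow>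
      curve_embeds I (profile_curve r z) J (profile_curve \<rho> \<zeta>) \<phi> \<Longrightarrow> \<phi> ` I = J"
    using max by (auto simp: maximal_hyp_grim_reaper_def)
  have sm: "smooth_on_real I r" "smooth_on_real I z" and r: "r ` I \<subseteq> {0<..<pi}"
    using gr by (auto simp: hyp_grim_reaper_def)
  from gr assms(2) show ?thesis
  proof (cases rule: hyp_grim_reaper_dichotomy)
    case 1
    have e: "curve_embeds I (profile_curve r z) UNIV (profile_curve (\<lambda>s. pi / 2) (\<lambda>s. s)) z"
      using 1(2) sm by (simp add: curve_embeds_def vec3_eq_iff 1(1) del: eq_divide_eq_numeral1)
    show ?thesis
      using hyp_surface_image_eq_of_curve_embeds[OF e ext[OF hyp_grim_reaper_vertical_plane e]]
      by (simp add: hyp_surface_image_vertical_plane)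
  next
    case (2 z0)
    have e: "curve_embeds I (profile_curve r z) {0<..<pi} (profile_curve (\<lambda>s. s) (\<lambda>s. z0)) r"
      using 2 sm r by (simp add: curve_embeds_def vec3_eq_iff)
    show ?thesis
      using hyp_surface_image_eq_of_curve_embeds[OF e ext[OF hyp_grim_reaper_slice e]]
      by (simp add: hyp_surface_image_slice)
  qed
qed

lemma maximal_hyp_grim_reaper_images:
  assumes "\<epsilon> \<noteq> 0"
  shows "{hyp_surface r z ` strip I | I r z. maximal_hyp_grim_reaper \<epsilon> I r z}
    = {vertical_plane} \<union> range slice"
proof
  show "{hyp_surface r z ` strip I | I r z. maximal_hyp_grim_reaper \<epsilon> I r z}
    \<subseteq> {vertical_plane} \<union> range slice"
    using maximal_hyp_grim_reaper_image[OF _ assms] by blast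
  have "vertical_plane \<in> {hyp_surface r z ` strip I | I r z. maximal_hyp_grim_reaper \<epsilon> I r z}"
    using maximal_vertical_plane[OF assms] hyp_surface_image_vertical_plane by blast
  moreover have "slice z0 \<in> {hyp_surface r z ` strip I | I r z. maximal_hyp_grim_reaper \<epsilon> I r z}" for z0
    using maximal_slice[OF assms] hyp_surface_image_slice by blast
  ultimately show "{vertical_plane} \<union> range slice
    \<subseteq> {hyp_surface r z ` strip I | I r z. maximal_hyp_grim_reaper \<epsilon> I r z}"
    by blast
qed

theorem theorem7p1:
  shows "maximal_hyp_c_plus_grim_reapers = {vertical_plane} \<union> range slice
    \<and> maximal_hyp_c_minus_grim_reapers = {vertical_plane} \<union> range slice"
  unfolding maximal_hyp_c_plus_grim_reapers_def maximal_hyp_c_minus_grim_reapers_def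
  by (intro conjI maximal_hyp_grim_reaper_images) simp_all

end
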